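(* $K_2(\mathrm{Maj})\le\omega(1)$. That is, every function $k(n)$ with $k(n)\to\infty$ (and $k(n)\le n$) belongs to $K_2(\mathrm{Maj})$.
   Context: $\mathcal{A}(n,k,p)$ is the set of all probability distributions $\mathbb{Q}$ of $n$ bits $(X_1,\ldots,X_n)\in\{0,1\}^n$ that are $k$-wise independent (every subset of at most $k$ of the bits is independent) and satisfy $\mathbb{Q}(X_i=1)=p$ for all $i$. For $f:\{0,1\}^n\to\{0,1\}$, $\varepsilon^f(k,p)=\max_{\mathbb{Q}\in\mathcal{A}(n,k,p)}\mathbb{Q}(f=1)-\min_{\mathbb{Q}\in\mathcal{A}(n,k,p)}\mathbb{Q}(f=1)$. For a sequence $f=(f_n)$ of monotone boolean functions with a sharp threshold at $p_c$ (under fully independent bits with marginal $p$, the probability of $f_n=1$ tends to $0$ for $p<p_c$ and to $1$ for $p>p_c$), $K_2(f)$ is the class of functions $k(n)$ such that $\varepsilon^{f_n}(k(n),p_c)\to0$ as $n\to\infty$. $\mathrm{Maj}_n$ ($n$ odd) is the majority function on $n$ bits; it has sharp threshold at $p_c=1/2$, and the sequence is indexed by odd $n$. All functions $k(n)$ are integer valued. *)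

theory Defs
  imports "HOL-Probability.Probability"
begin

text \<open>A string of \<open>n\<close> bits is a function on \<open>{..<n}\<close>, extended by \<open>False\<close> to all of \<open>nat\<close>.
  With this encoding the pointwise order on functions is the coordinatewise order on
  strings, and \<^const>\<open>Pi_pmf\<close> is the product distribution.\<close>

definition cube :: "nat \<Rightarrow> (nat \<Rightarrow> bool) set" where
  "cube n = PiE_dflt {..<n} False (\<lambda>_. UNIV)"

definition kwise_indep :: "nat \<Rightarrow> nat \<Rightarrow> real \<Rightarrow> (nat \<Rightarrow> bool) pmf set" where
  "kwise_indep n k p =
     {Q. set_pmf Q \<subseteq> cube n \<and>
         (\<forall>I \<subseteq> {..<n}. card I \<le> k \<longrightarrow>
            prob_space.indep_vars (measure_pmf Q) (\<lambda>_. count_space UNIV) (\<lambda>i x. x i) I) \<and>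
         (\<forall>i<n. measure_pmf.prob Q {x. x i} = p)}"

text \<open>For \<open>0 \<le> p \<le> 1\<close> the set \<^term>\<open>kwise_indep n k p\<close> is a nonempty compact subset of a
  finite-dimensional simplex, so that the supremum and infimum are a maximum and minimum.
  They are written as \<open>SUP\<close> and \<open>INF\<close> because \<^const>\<open>Max\<close> and \<^const>\<open>Min\<close> are
  meaningful for finite sets only.\<close>

definition eps :: "nat \<Rightarrow> ((nat \<Rightarrow> bool) \<Rightarrow> bool) \<Rightarrow> nat \<Rightarrow> real \<Rightarrow> real" where
  "eps n f k p =
     (SUP Q \<in> kwise_indep n k p. measure_pmf.prob Q {x. f x}) -
     (INF Q \<in> kwise_indep n k p. measure_pmf.prob Q {x. f x})"

text \<open>A sequence \<open>f\<close> of boolean functions is indexed by an infinite set \<open>N\<close> of numbers of bits,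
  and limits are taken as \<open>n\<close> tends to infinity within \<open>N\<close>.\<close>

definition at_top_in :: "nat set \<Rightarrow> nat filter" where
  "at_top_in N = inf at_top (principal N)"

definition sharp_threshold ::
  "nat set \<Rightarrow> (nat \<Rightarrow> (nat \<Rightarrow> bool) \<Rightarrow> bool) \<Rightarrow> real \<Rightarrow> bool" where
  "sharp_threshold N f pc \<longleftrightarrow>
     0 \<le> pc \<and> pc \<le> 1 \<and>
     (\<forall>p. 0 \<le> p \<and> p < pc \<longrightarrow>
        ((\<lambda>n. measure_pmf.prob (Pi_pmf {..<n} False (\<lambda>_. bernoulli_pmf p)) {x. f n x})
           \<longlongrightarrow> 0) (at_top_in N)) \<and>
     (\<forall>p. pc < p \<and> p \<le> 1 \<longrightarrow>
        ((\<lambda>n. measure_pmf.prob (Pi_pmf {..<n} False (\<lambda>_. bernoulli_pmf p)) {x. f n x})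
           \<longlongrightarrow> 1) (at_top_in N))"

text \<open>The critical probability \<open>pc\<close> is determined by \<open>f\<close> and \<open>N\<close>, and is passed explicitly.\<close>

definition K2 ::
  "nat set \<Rightarrow> (nat \<Rightarrow> (nat \<Rightarrow> bool) \<Rightarrow> bool) \<Rightarrow> real \<Rightarrow> (nat \<Rightarrow> nat) set" where
  "K2 N f pc =
     {k. (\<forall>n\<in>N. mono_on (cube n) (f n)) \<and> sharp_threshold N f pc \<and>
         ((\<lambda>n. eps n (f n) (k n) pc) \<longlongrightarrow> 0) (at_top_in N)}"

definition Maj :: "nat \<Rightarrow> (nat \<Rightarrow> bool) \<Rightarrow> bool" where
  "Maj n x \<longleftrightarrow> n < 2 * card {i. i < n \<and> x i}"

end

theory Submission
  imports Defs "HOL-Real_Asymp.Real_Asymp"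
begin

text \<open>Write the bits as signs and let \<open>S\<close> be their sum. Under any \<open>k\<close>-wise independent distribution
  with fair bits, the moments of \<open>S\<close> up to order \<open>k\<close> are those of the simple random walk. Hence the
  characteristic function of \<open>S / sqrt n\<close> differs from the one in the fully independent case by a
  Taylor remainder of order \<open>k\<close>, which tends to \<open>0\<close> as \<open>k\<close> tends to infinity. By Levy's continuity
  theorem \<open>S / sqrt n\<close> is asymptotically normal whichever distributions are chosen, and so the
  probability that \<open>S > 0\<close> has the same limit along near-maximisers and near-minimisers.\<close>

section \<open>Majority as the sign of a sum of signs\<close>

definition sgn_bit :: "bool \<Rightarrow> real" where
  "sgn_bit b = (if b then 1 else - 1)"

definition bit_sum :: "nat \<Rightarrow> (nat \<Rightarrow> bool) \<Rightarrow> real" where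
  "bit_sum n x = (\<Sum>i<n. sgn_bit (x i))"

lemma sgn_bit_simps [simp]: "sgn_bit True = 1" "sgn_bit False = - 1"
  by (auto simp: sgn_bit_def)

lemma sgn_bit_mult_self [simp]: "sgn_bit b * sgn_bit b = 1"
  by (cases b) auto

lemma bit_sum_eq: "bit_sum n x = 2 * real (card {i. i < n \<and> x i}) - real n"
proof -
  have "bit_sum n x = (\<Sum>i<n. 2 * (if x i then 1 else 0) - 1)"
    unfolding bit_sum_def by (intro sum.cong) (auto simp: sgn_bit_def)
  also have "\<dots> = 2 * (\<Sum>i<n. if x i then 1 else 0) - real n"
    by (simp add: sum_subtractf sum_distrib_left)
  also have "(\<Sum>i<n. if x i then 1 else 0 :: real) = real (card {i. i < n \<and> x i})"
    by (subst sum.inter_filter [symmetric]) auto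
  finally show ?thesis .
qed

text \<open>A tie makes \<open>bit_sum\<close> zero, and both sides are then false, so even
  \<open>n\<close> needs no exception.\<close>

lemma Maj_iff_bit_sum_pos: "Maj n x \<longleftrightarrow> 0 < bit_sum n x"
  unfolding Maj_def bit_sum_eq by linarith

lemma mono_on_Maj: "mono_on A (Maj n)"
proof (rule mono_onI)
  fix x y :: "nat \<Rightarrow> bool" assume "x \<le> y"
  hence "card {i. i < n \<and> x i} \<le> card {i. i < n \<and> y i}"
    by (intro card_mono) (auto simp: le_fun_def)
  thus "Maj n x \<le> Maj n y"
    by (auto simp: Maj_def)
qed

section \<open>Finite support and the fully independent distribution\<close>

lemma finite_cube: "finite (cube n)"
  unfolding cube_def by (intro finite_PiE_dflt) auto

lemma kwise_indep_integrable:
  fixes f :: "_ \<Rightarrow> 'a::{banach, second_countable_topology}"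
  assumes "Q \<in> kwise_indep n k p"
  shows "integrable (measure_pmf Q) f"
proof (rule integrable_measure_pmf_finite)
  show "finite (set_pmf Q)"
    using assms finite_cube[of n] by (auto simp: kwise_indep_def intro: finite_subset)
qed

text \<open>This member of the class serves twice: as the reference for comparing moments, and as a
  witness that the supremum and infimum in \<open>eps\<close> range over a nonempty set.\<close>

lemma Pi_pmf_bernoulli_in_kwise_indep:
  assumes "p \<in> {0..1}"
  shows "Pi_pmf {..<n} False (\<lambda>_. bernoulli_pmf p) \<in> kwise_indep n k p" (is "?P \<in> _")
proof -
  have "measure_pmf.prob ?P {x. x i} = p" if "i < n" for i
  proof -
    have "measure_pmf.prob ?P {x. x i} = measure_pmf.prob (map_pmf (\<lambda>x. x i) ?P) {True}"
      by (simp add: vimage_def)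
    also have "map_pmf (\<lambda>x. x i) ?P = bernoulli_pmf p"
      using that by (subst Pi_pmf_component) auto
    finally show ?thesis
      using assms by (simp add: measure_pmf_single)
  qed
  moreover have "set_pmf ?P \<subseteq> cube n"
    using set_Pi_pmf_subset'[of "{..<n}" False "\<lambda>_. bernoulli_pmf p"]
    by (auto simp: cube_def PiE_dflt_def)
  ultimately show ?thesis
    unfolding kwise_indep_def
    using prob_space.indep_vars_subset[OF measure_pmf.prob_space_axioms indep_vars_Pi_pmf[of "{..<n}"]] by auto
qed

section \<open>Expectations and moments fixed by \<open>k\<close>-wise independence\<close>

text \<open>A fair bit has mass 1/2 on each value. The codomain is a general field because both real
  functions (signs, \<open>exp\<close>) and complex ones (\<open>iexp\<close>) occur later.\<close>

lemma kwise_indep_expectation_bit: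
  fixes g :: "bool \<Rightarrow> 'a::{real_normed_field, banach, second_countable_topology}"
  assumes "Q \<in> kwise_indep n k (1/2)" "i < n"
  shows "measure_pmf.expectation Q (\<lambda>x. g (x i)) = (g True + g False) / 2"
proof -
  let ?B = "map_pmf (\<lambda>x. x i) Q"
  have T: "pmf ?B True = 1/2"
    using assms by (simp add: pmf_map vimage_def kwise_indep_def)
  have "pmf ?B True + pmf ?B False = (\<Sum>b\<in>UNIV. pmf ?B b)"
    by (simp add: UNIV_bool)
  also have "\<dots> = 1"
    by (intro sum_pmf_eq_1) auto
  finally have F: "pmf ?B False = 1/2"
    using T by simp
  have "measure_pmf.expectation Q (\<lambda>x. g (x i)) = measure_pmf.expectation ?B g"
    by simp
  also have "\<dots> = (\<Sum>b\<in>UNIV. pmf ?B b *\<^sub>R g b)"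
    by (intro integral_measure_pmf) auto
  also have "\<dots> = (g True + g False) / 2"
    by (simp add: UNIV_bool T F scaleR_conv_of_real field_simps)
  finally show ?thesis .
qed

text \<open>At most \<open>k\<close> bits are independent, so the expectation factorises. For
  \<open>k = n\<close> all bits may be taken at once, which gives the exponential moment and the
  characteristic function of the independent case.\<close>

lemma kwise_indep_expectation_prod:
  fixes g :: "bool \<Rightarrow> 'a::{real_normed_field, banach, second_countable_topology}"
  assumes Q: "Q \<in> kwise_indep n k (1/2)" and I: "I \<subseteq> {..<n}" "card I \<le> k"
  shows "measure_pmf.expectation Q (\<lambda>x. \<Prod>i\<in>I. g (x i)) = ((g True + g False) / 2) ^ card I"
proof -
  have "finite I"
    using I(1) finite_subset by blast
  have "prob_space.indep_vars (measure_pmf Q) (\<lambda>_. count_space UNIV) (\<lambda>i x. x i) I"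
    using Q I by (auto simp: kwise_indep_def)
  hence "prob_space.indep_vars (measure_pmf Q) (\<lambda>_. borel) (\<lambda>i x. g (x i)) I"
    by (rule prob_space.indep_vars_compose2[OF measure_pmf.prob_space_axioms]) auto
  hence "measure_pmf.expectation Q (\<lambda>x. \<Prod>i\<in>I. g (x i)) =
      (\<Prod>i\<in>I. measure_pmf.expectation Q (\<lambda>x. g (x i)))"
    by (intro prob_space.indep_vars_lebesgue_integral[OF measure_pmf.prob_space_axioms] \<open>finite I\<close> kwise_indep_integrable[OF Q])
  also have "\<dots> = (\<Prod>i\<in>I. (g True + g False) / 2)"
    using I by (intro prod.cong refl kwise_indep_expectation_bit[OF Q]) auto
  finally show ?thesis
    by simp
qed

text \<open>Multiplying the character \<open>\<Prod>i\<in>I. sgn_bit (x i)\<close> by \<open>sgn_bit (x a)\<close> inserts or removes \<open>a\<close>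
  in \<open>I\<close>, which turns each factor \<^const>\<open>bit_sum\<close> into a sum of characters of size at most one
  more.\<close>

lemma kwise_indep_moment_eq_aux:
  assumes Q: "Q \<in> kwise_indep n k (1/2)" and R: "R \<in> kwise_indep n k (1/2)"
  shows "I \<subseteq> {..<n} \<Longrightarrow> card I + j \<le> k \<Longrightarrow>
    measure_pmf.expectation Q (\<lambda>x. (\<Prod>i\<in>I. sgn_bit (x i)) * bit_sum n x ^ j) =
    measure_pmf.expectation R (\<lambda>x. (\<Prod>i\<in>I. sgn_bit (x i)) * bit_sum n x ^ j)"
proof (induction j arbitrary: I)
  case 0
  thus ?case
    using kwise_indep_expectation_prod[OF Q, of I sgn_bit]
      kwise_indep_expectation_prod[OF R, of I sgn_bit] by simp
next
  case (Suc j)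
  have "finite I"
    using Suc.prems(1) finite_subset by blast
  define J where "J a = (if a \<in> I then I - {a} else insert a I)" for a
  have J: "sgn_bit (x a) * (\<Prod>i\<in>I. sgn_bit (x i)) = (\<Prod>i\<in>J a. sgn_bit (x i))" for a x
    using \<open>finite I\<close> by (auto simp: J_def prod.remove[of I a] mult.assoc [symmetric])
  have card_J: "card (J a) \<le> Suc (card I)" for a
    using \<open>finite I\<close> by (auto simp: J_def card_insert_if)
  have expand: "measure_pmf.expectation P (\<lambda>x. (\<Prod>i\<in>I. sgn_bit (x i)) * bit_sum n x ^ Suc j) =
      (\<Sum>a<n. measure_pmf.expectation P (\<lambda>x. (\<Prod>i\<in>J a. sgn_bit (x i)) * bit_sum n x ^ j))"
    if "P \<in> kwise_indep n k (1/2)" for P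
  proof -
    have "(\<Prod>i\<in>I. sgn_bit (x i)) * bit_sum n x ^ Suc j =
        (\<Sum>a<n. (\<Prod>i\<in>J a. sgn_bit (x i)) * bit_sum n x ^ j)" for x
      unfolding power_Suc bit_sum_def[of n x] J[symmetric]
      by (simp add: sum_distrib_left sum_distrib_right mult_ac)
    thus ?thesis
      by (simp add: Bochner_Integration.integral_sum kwise_indep_integrable[OF that])
  qed
  show ?case
    unfolding expand[OF Q] expand[OF R]
  proof (intro sum.cong refl Suc.IH)
    fix a assume "a \<in> {..<n}"
    thus "J a \<subseteq> {..<n}" "card (J a) + j \<le> k"
      using Suc.prems card_J[of a] by (auto simp: J_def split: if_splits)
  qed
qed

lemma kwise_indep_moment_eq:
  assumes "Q \<in> kwise_indep n k (1/2)" "R \<in> kwise_indep n k (1/2)" "j \<le> k"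
  shows "measure_pmf.expectation Q (\<lambda>x. bit_sum n x ^ j) =
    measure_pmf.expectation R (\<lambda>x. bit_sum n x ^ j)"
  using kwise_indep_moment_eq_aux[OF assms(1,2), of "{}" j] assms(3) by simp

section \<open>Exponential moments and the Taylor remainder\<close>

text \<open>\<open>cosh\<close> is the moment generating function of a fair sign, so this is a case
  of Hoeffding's lemma.\<close>

lemma cosh_le_exp_half_square: "cosh s \<le> exp (s\<^sup>2 / 2)" for s :: real
proof -
  have nonneg: "cosh s \<le> exp (s\<^sup>2 / 2)" if "0 \<le> s" for s :: real
  proof -
    \<comment> \<open>Hoeffding's bound for a bit of mean 1/2 at argument \<open>2 * s\<close>; the
      left side equals the logarithm of \<open>cosh s\<close>.\<close>
    have "- (2 * s) * (1/2) + ln (1 + (1/2) * (exp (2 * s) - 1)) \<le> (2 * s)\<^sup>2 / 8"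
      using that by (intro Hoeffdings_lemma_aux) auto
    hence "ln (1 + (1/2) * (exp (2 * s) - 1)) \<le> s + s\<^sup>2 / 2"
      by (simp add: power2_eq_square)
    hence "exp (ln (1 + (1/2) * (exp (2 * s) - 1))) \<le> exp (s + s\<^sup>2 / 2)"
      by (rule exp_mono)
    moreover have "0 < 1 + (1/2) * (exp (2 * s) - 1)"
      by (simp add: field_simps add_pos_pos)
    moreover have "1 + (1/2) * (exp (2 * s) - 1) = exp s * cosh s"
      by (simp add: cosh_def field_simps flip: exp_add)
    ultimately have "exp s * cosh s \<le> exp s * exp (s\<^sup>2 / 2)"
      by (simp add: exp_add)
    thus ?thesis
      by simp
  qed
  show ?thesis
    using nonneg[of "\<bar>s\<bar>"] by (cases "0 \<le> s") auto
qed

text \<open>The left side is one term of the exponential series, whose terms are all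
  nonnegative.\<close>

lemma power_div_fact_le_exp:
  fixes x :: real
  assumes "0 \<le> x"
  shows "x ^ m / fact m \<le> exp x"
proof -
  have "(\<Sum>i\<in>{m}. x ^ i /\<^sub>R fact i) \<le> (\<Sum>i. x ^ i /\<^sub>R fact i)"
    using assms by (intro sum_le_suminf summable_exp_generic) auto
  thus ?thesis
    by (simp add: exp_def divide_inverse mult.commute)
qed

text \<open>The moment bound comes from the exponential moment at twice the argument; the factor \<open>4 ^ m\<close>
  gained in this way makes the Taylor remainder of the characteristic function vanish.\<close>

lemma iid_even_moment_bound:
  assumes R: "R \<in> kwise_indep n n (1/2)" and n: "n > 0"
  shows "measure_pmf.expectation R (\<lambda>x. (t * bit_sum n x / sqrt n) ^ (2 * m)) / fact (2 * m)
    \<le> 2 * exp (2 * t\<^sup>2) / 4 ^ m"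
proof -
  have mgf: "measure_pmf.expectation R (\<lambda>x. exp (s * bit_sum n x)) = cosh s ^ n" for s
  proof -
    have "exp (s * bit_sum n x) = (\<Prod>i<n. exp (s * sgn_bit (x i)))" for x
      by (simp add: bit_sum_def sum_distrib_left exp_sum)
    thus ?thesis
      using kwise_indep_expectation_prod[OF R, of "{..<n}" "\<lambda>b. exp (s * sgn_bit b)"]
      by (simp add: cosh_def)
  qed
  \<comment> \<open>Dividing by \<open>sqrt n\<close> makes \<open>exp (s\<^sup>2 / 2) ^ n\<close>
    independent of \<open>n\<close>; the factor 2 becomes \<open>4 ^ m\<close> when raised to the
    power \<open>2 * m\<close>.\<close>
  define s where "s = 2 * t / sqrt n"
  have s: "real n * (s\<^sup>2 / 2) = 2 * t\<^sup>2"
    using n by (simp add: s_def power_divide power_mult_distrib)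
  have "(t * bit_sum n x / sqrt n) ^ (2 * m) / fact (2 * m) * 4 ^ m
      \<le> exp (s * bit_sum n x) + exp ((- s) * bit_sum n x)" for x
  proof -
    have "(t * bit_sum n x / sqrt n) ^ (2 * m) * 4 ^ m = (s * bit_sum n x) ^ (2 * m)"
      unfolding s_def by (simp add: power_mult power_mult_distrib power_divide)
    also have "\<dots> = \<bar>s * bit_sum n x\<bar> ^ (2 * m)"
      by (simp add: power_mult)
    finally have "(t * bit_sum n x / sqrt n) ^ (2 * m) / fact (2 * m) * 4 ^ m =
        \<bar>s * bit_sum n x\<bar> ^ (2 * m) / fact (2 * m)"
      by (simp add: mult.commute)
    also have "\<dots> \<le> exp \<bar>s * bit_sum n x\<bar>"
      by (rule power_div_fact_le_exp) auto
    also have "\<dots> \<le> exp (s * bit_sum n x) + exp ((- s) * bit_sum n x)"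
      by (cases "0 \<le> s * bit_sum n x") (auto simp: add_increasing add_increasing2)
    finally show ?thesis .
  qed
  hence "measure_pmf.expectation R (\<lambda>x. (t * bit_sum n x / sqrt n) ^ (2 * m) / fact (2 * m) * 4 ^ m)
      \<le> measure_pmf.expectation R (\<lambda>x. exp (s * bit_sum n x) + exp ((- s) * bit_sum n x))"
    by (intro integral_mono kwise_indep_integrable[OF R])
  also have "\<dots> = cosh s ^ n + cosh (- s) ^ n"
    by (subst Bochner_Integration.integral_add)
       (simp_all only: mgf kwise_indep_integrable[OF R])
  also have "\<dots> = 2 * cosh s ^ n"
    by simp
  also have "\<dots> \<le> 2 * exp (s\<^sup>2 / 2) ^ n"
    by (intro mult_left_mono power_mono cosh_le_exp_half_square) auto
  also have "\<dots> = 2 * exp (2 * t\<^sup>2)"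
    by (simp only: exp_of_nat_mult [symmetric] s)
  finally show ?thesis
    by (simp add: field_simps)
qed

text \<open>With an even order no absolute value remains in the error, so the bound is itself a
  moment of \<open>X\<close>. For multiples of \<open>bit_sum\<close> it is therefore fixed by
  \<open>k\<close>-wise independence as soon as \<open>2 * m \<le> k\<close>.\<close>

lemma expectation_iexp_taylor:
  fixes X :: "'a \<Rightarrow> real"
  assumes "finite (set_pmf Q)" "m > 0"
  shows "cmod (measure_pmf.expectation Q (\<lambda>x. iexp (X x)) -
      (\<Sum>j<2*m. \<i> ^ j / fact j * of_real (measure_pmf.expectation Q (\<lambda>x. X x ^ j))))
    \<le> measure_pmf.expectation Q (\<lambda>x. X x ^ (2 * m)) / fact (2 * m)"
proof -
  have int: "integrable (measure_pmf Q) f" for f :: "'a \<Rightarrow> 'b::{banach, second_countable_topology}"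
    using assms(1) by (rule integrable_measure_pmf_finite)
  have le: "cmod (iexp (X x) - (\<Sum>j<2*m. \<i> ^ j / fact j * of_real (X x ^ j)))
      \<le> X x ^ (2 * m) / fact (2 * m)" for x
  proof -
    \<comment> \<open>The sum in \<open>iexp_approx1\<close> includes its last index, so the bound
      is used at \<open>2 * m - 1\<close>; the rewriting needs \<open>m > 0\<close>.\<close>
    have "{..<2*m} = {..2 * m - 1}" "Suc (2 * m - 1) = 2 * m"
      using assms(2) by auto
    thus ?thesis
      using iexp_approx1[of "X x" "2 * m - 1"]
      by (simp add: power_mult_distrib power_mult)
  qed
  have "measure_pmf.expectation Q (\<lambda>x. \<Sum>j<2*m. \<i> ^ j / fact j * of_real (X x ^ j)) =
      (\<Sum>j<2*m. \<i> ^ j / fact j * of_real (measure_pmf.expectation Q (\<lambda>x. X x ^ j)))"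
    by (subst Bochner_Integration.integral_sum)
       (simp_all only: int integral_mult_right_zero integral_complex_of_real)
  hence "measure_pmf.expectation Q (\<lambda>x. iexp (X x)) -
      (\<Sum>j<2*m. \<i> ^ j / fact j * of_real (measure_pmf.expectation Q (\<lambda>x. X x ^ j))) =
    measure_pmf.expectation Q
      (\<lambda>x. iexp (X x) - (\<Sum>j<2*m. \<i> ^ j / fact j * of_real (X x ^ j)))"
    by (subst Bochner_Integration.integral_diff) (simp_all only: int)
  also have "cmod \<dots> \<le> measure_pmf.expectation Q
      (\<lambda>x. cmod (iexp (X x) - (\<Sum>j<2*m. \<i> ^ j / fact j * of_real (X x ^ j))))"
    by (rule integral_norm_bound)
  also have "\<dots> \<le> measure_pmf.expectation Q (\<lambda>x. X x ^ (2 * m) / fact (2 * m))"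
    by (intro integral_mono int le)
  finally show ?thesis
    by simp
qed

text \<open>The characteristic function of a sum of independent signs is a product in which each
  fair sign contributes a cosine.\<close>

lemma iid_iexp_expectation:
  assumes R: "R \<in> kwise_indep n n (1/2)"
  shows "measure_pmf.expectation R (\<lambda>x. iexp (t * bit_sum n x / sqrt n)) =
    of_real (cos (t / sqrt n) ^ n)"
proof -
  have "iexp (t * bit_sum n x / sqrt n) = (\<Prod>i<n. iexp (t / sqrt n * sgn_bit (x i)))" for x
    by (simp add: bit_sum_def sum_distrib_left sum_divide_distrib exp_sum)
  hence "measure_pmf.expectation R (\<lambda>x. iexp (t * bit_sum n x / sqrt n)) =
      ((iexp (t / sqrt n * sgn_bit True) + iexp (t / sqrt n * sgn_bit False)) / 2) ^ n"
    using kwise_indep_expectation_prod[OF R, of "{..<n}" "\<lambda>b. iexp (t / sqrt n * sgn_bit b)"]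
    by (simp only: card_lessThan order_refl simp_thms)
  also have "(iexp (s * sgn_bit True) + iexp (s * sgn_bit False)) / 2 = of_real (cos s)" for s
    by (simp add: cos_exp_eq cos_of_real [symmetric])
  finally show ?thesis
    by simp
qed

text \<open>Both characteristic functions are compared with one Taylor polynomial \<open>T\<close>.
  Its coefficients use moments of order below \<open>2 * m\<close>, and the error bound is the
  moment of order \<open>2 * m\<close>; all of these agree under \<open>Q\<close> and under
  independent bits. The two equal error bounds add up by the triangle inequality.\<close>

lemma iexp_expectation_kwise_indep_diff:
  assumes Q: "Q \<in> kwise_indep n k (1/2)" and n: "n > 0" and m: "m > 0" "2 * m \<le> k"
  shows "cmod (measure_pmf.expectation Q (\<lambda>x. iexp (t * bit_sum n x / sqrt n)) -
    of_real (cos (t / sqrt n) ^ n)) \<le> 4 * exp (2 * t\<^sup>2) / 4 ^ m"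
proof -
  define R where "R = Pi_pmf {..<n} False (\<lambda>_. bernoulli_pmf (1/2))"
  have R: "R \<in> kwise_indep n j (1/2)" for j
    unfolding R_def by (rule Pi_pmf_bernoulli_in_kwise_indep) auto
  have moment: "measure_pmf.expectation Q (\<lambda>x. (t * bit_sum n x / sqrt n) ^ j) =
      measure_pmf.expectation R (\<lambda>x. (t * bit_sum n x / sqrt n) ^ j)" if "j \<le> 2 * m" for j
    using kwise_indep_moment_eq[OF Q R, of j] that m
    by (simp add: power_mult_distrib power_divide)
  define T where "T = (\<Sum>j<2*m. \<i> ^ j / fact j *
    complex_of_real (measure_pmf.expectation R (\<lambda>x. (t * bit_sum n x / sqrt n) ^ j)))"
  have fin: "finite (set_pmf P)" if "P \<in> kwise_indep n j (1/2)" for P j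
    using that finite_cube[of n] by (auto simp: kwise_indep_def intro: finite_subset)
  have "T = (\<Sum>j<2*m. \<i> ^ j / fact j *
      complex_of_real (measure_pmf.expectation Q (\<lambda>x. (t * bit_sum n x / sqrt n) ^ j)))"
    unfolding T_def by (intro sum.cong) (auto simp: moment)
  hence "cmod (measure_pmf.expectation Q (\<lambda>x. iexp (t * bit_sum n x / sqrt n)) - T)
      \<le> measure_pmf.expectation R (\<lambda>x. (t * bit_sum n x / sqrt n) ^ (2 * m)) / fact (2 * m)"
    using expectation_iexp_taylor[OF fin[OF Q] m(1), of "\<lambda>x. t * bit_sum n x / sqrt n"]
    by (simp only: moment[OF order_refl])
  moreover have "cmod (measure_pmf.expectation R (\<lambda>x. iexp (t * bit_sum n x / sqrt n)) - T)
      \<le> measure_pmf.expectation R (\<lambda>x. (t * bit_sum n x / sqrt n) ^ (2 * m)) / fact (2 * m)"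
    unfolding T_def by (rule expectation_iexp_taylor[OF fin[OF R] m(1)])
  ultimately have le: "cmod (measure_pmf.expectation Q (\<lambda>x. iexp (t * bit_sum n x / sqrt n)) - T) \<le>
        2 * exp (2 * t\<^sup>2) / 4 ^ m"
      "cmod (T - measure_pmf.expectation R (\<lambda>x. iexp (t * bit_sum n x / sqrt n))) \<le>
        2 * exp (2 * t\<^sup>2) / 4 ^ m"
    using iid_even_moment_bound[OF R n, of t m]
    by (auto simp only: norm_minus_commute[of T] intro: order.trans)
  show ?thesis
    using norm_diff_triangle_le[OF le] unfolding iid_iexp_expectation[OF R] by simp
qed

section \<open>Convergence to the normal law\<close>

text \<open>The expansion \<open>cos u = 1 - u^2/2 + ...\<close> at \<open>u = t / sqrt n\<close>
  leads to the characteristic function of the standard normal law.\<close>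

lemma cos_power_tendsto: "(\<lambda>n. cos (t / sqrt (real n)) ^ n) \<longlonglongrightarrow> exp (- t\<^sup>2 / 2)" for t :: real
proof -
  have "(\<lambda>n. cos (t / sqrt (real n)) ^ n) \<longlonglongrightarrow> exp (- (t * t / 2))"
    by real_asymp
  thus ?thesis
    by (simp add: power2_eq_square)
qed

text \<open>What counts is that the limit is the same for every choice of \<open>Q\<close>, since
  nearly extremal distributions will be inserted.\<close>

lemma kwise_indep_prob_Maj_tendsto:
  assumes k: "filterlim k at_top at_top" and Q: "\<And>n. Q n \<in> kwise_indep n (k n) (1/2)"
  shows "(\<lambda>n. measure_pmf.prob (Q n) {x. Maj n x}) \<longlonglongrightarrow> 1 - cdf std_normal_distribution 0"
proof -
  define M where "M n = distr (measure_pmf (Q n)) borel (\<lambda>x. bit_sum n x / sqrt n)" for n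
  have char_M: "char (M n) t = measure_pmf.expectation (Q n) (\<lambda>x. iexp (t * bit_sum n x / sqrt n))"
    for n t
    unfolding char_def M_def by (subst integral_distr) auto
  have "weak_conv_m M std_normal_distribution"
  proof (rule levy_continuity)
    show "real_distribution (M n)" for n
      unfolding M_def by (rule prob_space.real_distribution_distr[OF measure_pmf.prob_space_axioms]) auto
    show "real_distribution std_normal_distribution"
      by (rule real_dist_normal_dist)
    fix t :: real
    have "(\<lambda>n. char (M n) t - of_real (cos (t / sqrt n) ^ n)) \<longlonglongrightarrow> 0"
    proof (rule Lim_null_comparison)
      show "\<forall>\<^sub>F n in sequentially. cmod (char (M n) t - of_real (cos (t / sqrt n) ^ n))
          \<le> 4 * exp (2 * t\<^sup>2) / 4 ^ (k n div 2)"
        using eventually_gt_at_top[of 0] eventually_compose_filterlim[OF eventually_ge_at_top[of 2] k]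
      proof eventually_elim
        case (elim n)
        \<comment> \<open>The order is \<open>m = k n div 2\<close>, the largest with
          \<open>2 * m \<le> k n\<close>; it is positive because \<open>k n\<close> is at least
          2.\<close>
        show ?case
          unfolding char_M by (rule iexp_expectation_kwise_indep_diff[OF Q]) (use elim in auto)
      qed
      have "(\<lambda>j. 4 * exp (2 * t\<^sup>2) / 4 ^ (j div 2)) \<longlonglongrightarrow> 0"
      proof (rule filterlim_compose[of "\<lambda>j. 4 * exp (2 * t\<^sup>2) / 4 ^ j" _ sequentially])
        show "filterlim (\<lambda>j::nat. j div 2) at_top at_top"
          by (rule filterlim_at_top_div_const_nat) auto
      qed real_asymp
      thus "(\<lambda>n. 4 * exp (2 * t\<^sup>2) / 4 ^ (k n div 2)) \<longlonglongrightarrow> 0"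
        using k by (rule filterlim_compose)
    qed
    moreover have "(\<lambda>n. complex_of_real (cos (t / sqrt n) ^ n)) \<longlonglongrightarrow> of_real (exp (- t\<^sup>2 / 2))"
      by (intro tendsto_of_real cos_power_tendsto)
    ultimately have "(\<lambda>n. char (M n) t - of_real (cos (t / sqrt n) ^ n) +
        of_real (cos (t / sqrt n) ^ n)) \<longlonglongrightarrow> 0 + complex_of_real (exp (- t\<^sup>2 / 2))"
      by (rule tendsto_add)
    thus "(\<lambda>n. char (M n) t) \<longlonglongrightarrow> char std_normal_distribution t"
      unfolding char_std_normal_distribution by simp
  qed
  \<comment> \<open>Weak convergence gives convergence of distribution functions at continuity
    points; 0 is one because the normal law has a density.\<close>
  moreover have "isCont (cdf std_normal_distribution) 0"
  proof -
    interpret N: real_distribution std_normal_distribution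
      by (rule real_dist_normal_dist)
    have "emeasure std_normal_distribution {0} = 0"
      by (subst emeasure_density) (auto simp: nn_integral_0_iff_AE intro: AE_mp[OF AE_lborel_singleton[of 0]])
    thus ?thesis
      unfolding N.isCont_cdf measure_def by simp
  qed
  ultimately have "(\<lambda>n. cdf (M n) 0) \<longlonglongrightarrow> cdf std_normal_distribution 0"
    by (simp add: weak_conv_m_def weak_conv_def)
  hence "(\<lambda>n. 1 - cdf (M n) 0) \<longlonglongrightarrow> 1 - cdf std_normal_distribution 0"
    by (intro tendsto_intros)
  moreover have "1 - cdf (M n) 0 = measure_pmf.prob (Q n) {x. Maj n x}" for n
  proof -
    \<comment> \<open>Ties fall under \<open>\<le> 0\<close>. For \<open>n = 0\<close> both sides
      hold: the quotient is 0 and \<open>Maj\<close> is false.\<close>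
    have "bit_sum n x / sqrt n \<le> 0 \<longleftrightarrow> \<not> Maj n x" for x
      by (cases "n = 0") (auto simp: Maj_iff_bit_sum_pos divide_le_0_iff, simp add: bit_sum_def)
    hence "cdf (M n) 0 = measure_pmf.prob (Q n) (UNIV - {x. Maj n x})"
      unfolding cdf_def M_def by (subst measure_distr) (auto intro!: arg_cong[where f = "measure _"])
    also have "\<dots> = 1 - measure_pmf.prob (Q n) {x. Maj n x}"
      using measure_pmf.prob_compl[of "{x. Maj n x}" "Q n"] by simp
    finally show ?thesis
      by simp
  qed
  ultimately show ?thesis
    by simp
qed

section \<open>From arbitrary choices of distributions to \<open>eps\<close>\<close>

text \<open>For each \<open>n\<close> a near-maximiser \<open>U n\<close> and a near-minimiser
  \<open>L n\<close> are picked. Along both choices the probabilities tend to the same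
  \<open>c\<close>, so the gap vanishes.\<close>

lemma eps_tendsto_0:
  assumes p: "p \<in> {0..1}"
    and lim: "\<And>Q. (\<And>n. Q n \<in> kwise_indep n (k n) p) \<Longrightarrow>
      (\<lambda>n. measure_pmf.prob (Q n) {x. f n x}) \<longlonglongrightarrow> c"
  shows "(\<lambda>n. eps n (f n) (k n) p) \<longlonglongrightarrow> 0"
proof -
  define K where "K n = kwise_indep n (k n) p" for n
  define P where "P n Q = measure_pmf.prob Q {x. f n x}" for n Q
  have ne: "K n \<noteq> {}" for n
    using Pi_pmf_bernoulli_in_kwise_indep[OF p] by (auto simp: K_def)
  have bdd: "bdd_above (P n ` K n)" "bdd_below (P n ` K n)" for n
    unfolding P_def by (auto intro!: bdd_aboveI2[of _ _ 1] bdd_belowI2[of _ 0])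
  \<comment> \<open>The slack \<open>1 / Suc n\<close> is positive even at \<open>n = 0\<close>, as
    the strict inequality requires.\<close>
  have "\<exists>Q\<in>K n. (SUP Q\<in>K n. P n Q) - 1 / real (Suc n) < P n Q" for n
    by (subst less_cSUP_iff [symmetric, OF ne bdd(1)]) auto
  then obtain U where U: "\<And>n. U n \<in> K n" "\<And>n. (SUP Q\<in>K n. P n Q) - 1 / real (Suc n) < P n (U n)"
    by metis
  have "\<exists>Q\<in>K n. P n Q < (INF Q\<in>K n. P n Q) + 1 / real (Suc n)" for n
    by (subst cINF_less_iff [symmetric, OF ne bdd(2)]) auto
  then obtain L where L: "\<And>n. L n \<in> K n" "\<And>n. P n (L n) < (INF Q\<in>K n. P n Q) + 1 / real (Suc n)"
    by metis
  show ?thesis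
  proof (rule tendsto_sandwich)
    show "\<forall>\<^sub>F n in sequentially. 0 \<le> eps n (f n) (k n) p"
    proof (intro always_eventually allI)
      fix n
      show "0 \<le> eps n (f n) (k n) p"
        using cSUP_upper[OF U(1) bdd(1), of n] cINF_lower[OF bdd(2) U(1), of n]
        by (simp add: eps_def K_def P_def)
    qed
    show "\<forall>\<^sub>F n in sequentially. eps n (f n) (k n) p
        \<le> P n (U n) - P n (L n) + (1 / real (Suc n) + 1 / real (Suc n))"
    proof (intro always_eventually allI)
      fix n
      show "eps n (f n) (k n) p \<le> P n (U n) - P n (L n) + (1 / real (Suc n) + 1 / real (Suc n))"
        using U(2)[of n] L(2)[of n] unfolding eps_def K_def P_def by linarith
    qed
    have "(\<lambda>n. P n (U n) - P n (L n) + (1 / real (Suc n) + 1 / real (Suc n)))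
        \<longlonglongrightarrow> c - c + (0 + 0)"
      using U(1) L(1) unfolding P_def K_def by (intro tendsto_intros lim) (auto, real_asymp+)
    thus "(\<lambda>n. P n (U n) - P n (L n) + (1 / real (Suc n) + 1 / real (Suc n))) \<longlonglongrightarrow> 0"
      by simp
  qed auto
qed

section \<open>The threshold of majority\<close>

text \<open>The number of ones is binomial, and Hoeffding's inequality with deviation
  \<open>\<bar>1/2 - p\<bar>\<close> bounds the unlikely outcome exponentially. The limits hold
  along all \<open>n\<close>, hence along any \<open>N\<close>.\<close>

lemma sharp_threshold_Maj: "sharp_threshold N Maj (1/2)"
proof -
  define P where "P p n = measure_pmf.prob (Pi_pmf {..<n} False (\<lambda>_. bernoulli_pmf p)) {x. Maj n x}"
    for p n
  have P_eq: "P p n = measure_pmf.prob (binomial_pmf n p) {c. n < 2 * c}" if "p \<in> {0..1}" for p n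
    using that unfolding P_def Maj_def
    by (subst binomial_pmf_altdef'[of "{..<n}" n p False]) (auto simp: vimage_def)
  have lim: "(\<lambda>n. exp (- 2 * real n * (1/2 - p)\<^sup>2)) \<longlonglongrightarrow> 0" if "p \<noteq> 1/2" for p :: real
  proof -
    have "0 < (1/2 - p)\<^sup>2"
      using that by simp
    thus ?thesis
      by real_asymp
  qed
  have below: "P p \<longlonglongrightarrow> 0" if "0 \<le> p" "p < 1/2" for p
  proof (rule tendsto_sandwich)
    have p: "p \<in> {0..1}"
      using that by simp
    show "\<forall>\<^sub>F n in sequentially. P p n \<le> exp (- 2 * real n * (1/2 - p)\<^sup>2)"
      using eventually_gt_at_top[of 0]
    proof eventually_elim
      case (elim n)
      have "P p n \<le> measure_pmf.prob (binomial_pmf n p) {c. p + (1/2 - p) \<le> real c / real n}"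
        unfolding P_eq[of p, OF p] using elim
        by (intro measure_pmf.finite_measure_mono) (auto simp: field_simps)
      also have "\<dots> \<le> exp (- 2 * real n * (1/2 - p)\<^sup>2)"
        using elim that binomial_distribution.prob_ge'[of p n "1/2 - p"] p
        by (simp add: binomial_distribution_def)
      finally show ?case .
    qed
  qed (use that lim in \<open>auto simp: P_def\<close>)
  have above: "P p \<longlonglongrightarrow> 1" if "1/2 < p" "p \<le> 1" for p
  proof (rule tendsto_sandwich)
    have p: "p \<in> {0..1}"
      using that by simp
    show "\<forall>\<^sub>F n in sequentially. 1 - exp (- 2 * real n * (1/2 - p)\<^sup>2) \<le> P p n"
      using eventually_gt_at_top[of 0]
    proof eventually_elim
      case (elim n)
      have "1 - P p n = measure_pmf.prob (binomial_pmf n p) (UNIV - {c. n < 2 * c})"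
        unfolding P_eq[of p, OF p] using measure_pmf.prob_compl[of "{c. n < 2 * c}" "binomial_pmf n p"] by simp
      also have "\<dots> \<le> measure_pmf.prob (binomial_pmf n p) {c. real c / real n \<le> p - (p - 1/2)}"
        using elim by (intro measure_pmf.finite_measure_mono) (auto simp: field_simps)
      also have "\<dots> \<le> exp (- 2 * real n * (p - 1/2)\<^sup>2)"
        using elim that binomial_distribution.prob_le'[of p n "p - 1/2"] p
        by (simp add: binomial_distribution_def)
      finally show ?case
        by (simp add: power2_commute)
    qed
    show "(\<lambda>n. 1 - exp (- 2 * real n * (1/2 - p)\<^sup>2)) \<longlonglongrightarrow> 1"
      using tendsto_diff[OF tendsto_const lim[of p], of 1] that by simp
  qed (auto simp: P_def)
  have "at_top_in N \<le> sequentially"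
    by (simp add: at_top_in_def)
  thus ?thesis
    unfolding sharp_threshold_def P_def[symmetric]
    using below above by (auto intro: tendsto_mono[of _ sequentially])
qed

theorem proposition9:
  fixes k :: "nat \<Rightarrow> nat"
  assumes "filterlim k at_top (at_top_in {n. odd n})"
    and "\<forall>n. odd n \<longrightarrow> k n \<le> n"
  shows "k \<in> K2 {n. odd n} Maj (1/2)"
proof -
  \<comment> \<open>The limit lemmas run over all \<open>n\<close>, whereas \<open>k\<close> is
    assumed to tend to infinity only along odd \<open>n\<close>. The value \<open>n\<close> at even
    \<open>n\<close> fills the gap and leaves \<open>eps\<close> at odd \<open>n\<close>
    unchanged.\<close>
  define k' where "k' n = (if odd n then k n else n)" for n
  have "filterlim k' at_top at_top"
    unfolding k'_def
    using assms(1) by (intro filterlim_If filterlim_mono[OF filterlim_ident]) (auto simp: at_top_in_def)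
  hence "(\<lambda>n. eps n (Maj n) (k' n) (1/2)) \<longlonglongrightarrow> 0"
    by (intro eps_tendsto_0[OF _ kwise_indep_prob_Maj_tendsto]) auto
  hence "((\<lambda>n. eps n (Maj n) (k' n) (1/2)) \<longlongrightarrow> 0) (at_top_in {n. odd n})"
    by (rule tendsto_mono[rotated]) (simp add: at_top_in_def)
  moreover have "\<forall>\<^sub>F n in at_top_in {n. odd n}.
      eps n (Maj n) (k' n) (1/2) = eps n (Maj n) (k n) (1/2)"
    unfolding at_top_in_def eventually_inf_principal by (simp add: k'_def)
  ultimately have "((\<lambda>n. eps n (Maj n) (k n) (1/2)) \<longlongrightarrow> 0) (at_top_in {n. odd n})"
    by (rule Lim_transform_eventually)
  thus ?thesis
    by (simp add: K2_def mono_on_Maj sharp_threshold_Maj)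
qed

end
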